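(* Let $n\ge 4$ be an even integer, $K$ a field, and $T=K[x_1,\ldots,x_n,y_1,\ldots,y_n]$, with indices of variables taken modulo $n$ (so $x_0=x_n$, $y_0=y_n$). Let $J\subset T$ be the defining ideal of the Rees algebra $R(I_{\frac n2}(C_n))$. Let $L=(f_1,\ldots,f_n)\subset T$, where $f_j=x_{\frac n2+j}y_j-x_jy_{j+1}$ for $j=1,\ldots,n$, and let $H=(h_1,\ldots,h_{\frac n2-1})\subset K[y_1,\ldots,y_n]$, where $h_l=y_ly_{l+\frac n2}-y_0y_{\frac n2}$ for $l=1,\ldots,\frac n2-1$. Then $J=L+HT$.
   Context: Let $S=K[x_1,\ldots,x_n]$. $I_{\frac n2}(C_n)\subset S$ is the $\frac n2$-path ideal of the $n$-cycle, generated by the monomials $u_j=x_jx_{j+1}\cdots x_{j+\frac n2-1}$, $j=1,\ldots,n$ (indices modulo $n$). The Rees algebra of $I=I_{\frac n2}(C_n)$ is $R(I)=S[u_1s,\ldots,u_ns]\subset S[s]$, with $s$ a new variable, and its defining ideal is $J=\ker(\varphi)$, where $\varphi:T=S[y_1,\ldots,y_n]\to R(I)$ is the surjective $K$-algebra homomorphism with $\varphi(x_i)=x_i$ and $\varphi(y_j)=u_js$. *)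

theory Defs
  imports
    "HOL-Library.Poly_Mapping"
    "HOL-Algebra.Ideal"
    "HOL-Algebra.RingHom"
    "HOL-Algebra.Generated_Rings"
begin

text \<open>
  Every polynomial ring below is a subring of one ambient ring, the polynomials over the
  field \<open>K\<close> (a type of class \<open>field\<close>) in the variables \<open>X i\<close>, \<open>Y i\<close> (\<open>i\<close> a natural number)
  and \<open>Z\<close>, where \<open>Z\<close> plays the part of the new variable \<open>s\<close>. A monomial is a finitely
  supported exponent function, a polynomial a finitely supported coefficient function.
\<close>

datatype var = X nat | Y nat | Z

type_synonym 'a mpol = "(var \<Rightarrow>\<^sub>0 nat) \<Rightarrow>\<^sub>0 'a"

definition Const :: "'a \<Rightarrow> 'a::comm_ring_1 mpol" where
  "Const c = Poly_Mapping.single 0 c"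

definition Var :: "var \<Rightarrow> 'a::comm_ring_1 mpol" where
  "Var v = Poly_Mapping.single (Poly_Mapping.single v 1) 1"

definition poly_ring :: "var set \<Rightarrow> 'a::comm_ring_1 mpol ring" where
  "poly_ring V =
     \<lparr>carrier = {p. \<forall>m\<in>Poly_Mapping.keys p. Poly_Mapping.keys m \<subseteq> V},
      mult = (*), one = 1, zero = 0, add = (+)\<rparr>"

definition subst_mono :: "(var \<Rightarrow> 'a::comm_ring_1 mpol) \<Rightarrow> (var \<Rightarrow>\<^sub>0 nat) \<Rightarrow> 'a mpol" where
  "subst_mono g m = (\<Prod>v\<in>Poly_Mapping.keys m. g v ^ Poly_Mapping.lookup m v)"

text \<open>The \<open>K\<close>-algebra homomorphism sending each variable \<open>v\<close> to \<open>g v\<close>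
  (see \<open>subst_add\<close>, \<open>subst_mult\<close>, \<open>subst_Const\<close> and \<open>subst_Var\<close> below).\<close>

definition subst :: "(var \<Rightarrow> 'a::comm_ring_1 mpol) \<Rightarrow> 'a mpol \<Rightarrow> 'a mpol" where
  "subst g p = (\<Sum>m\<in>Poly_Mapping.keys p. Const (Poly_Mapping.lookup p m) * subst_mono g m)"

text \<open>Indices are read modulo \<open>n\<close>, with representatives \<open>0, \<dots>, n - 1\<close>: the variables
  \<open>x\<^sub>n\<close> and \<open>y\<^sub>n\<close> appear as \<open>x\<^sub>0\<close> and \<open>y\<^sub>0\<close>.\<close>

definition xvar :: "nat \<Rightarrow> nat \<Rightarrow> 'a::comm_ring_1 mpol" where
  "xvar n i = Var (X (i mod n))"

definition yvar :: "nat \<Rightarrow> nat \<Rightarrow> 'a::comm_ring_1 mpol" where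
  "yvar n j = Var (Y (j mod n))"

definition ring_S :: "nat \<Rightarrow> 'a::comm_ring_1 mpol ring" where
  "ring_S n = poly_ring (X ` {..<n})"

definition ring_Ss :: "nat \<Rightarrow> 'a::comm_ring_1 mpol ring" where
  "ring_Ss n = poly_ring (insert Z (X ` {..<n}))"

definition ring_T :: "nat \<Rightarrow> 'a::comm_ring_1 mpol ring" where
  "ring_T n = poly_ring (X ` {..<n} \<union> Y ` {..<n})"

definition ring_Ky :: "nat \<Rightarrow> 'a::comm_ring_1 mpol ring" where
  "ring_Ky n = poly_ring (Y ` {..<n})"

text \<open>The generators \<open>u\<^sub>j = x\<^sub>j x\<^sub>j\<^sub>+\<^sub>1 \<dots> x\<^sub>j\<^sub>+\<^sub>t\<^sub>-\<^sub>1\<close> of the \<open>t\<close>-path ideal of the \<open>n\<close>-cycle.\<close>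

definition path_gen :: "nat \<Rightarrow> nat \<Rightarrow> nat \<Rightarrow> 'a::comm_ring_1 mpol" where
  "path_gen n t j = (\<Prod>i<t. xvar n (j + i))"

definition rees_algebra :: "nat \<Rightarrow> nat \<Rightarrow> 'a::comm_ring_1 mpol ring" where
  "rees_algebra n t = ring_Ss n
     \<lparr>carrier := generate_ring (ring_Ss n)
        (carrier (ring_S n) \<union> (\<lambda>j. path_gen n t j * Var Z) ` {1..n})\<rparr>"

text \<open>The value at \<open>Z\<close>, which does not occur in \<open>T\<close>, is irrelevant.\<close>

definition rees_map :: "nat \<Rightarrow> nat \<Rightarrow> 'a::comm_ring_1 mpol \<Rightarrow> 'a mpol" where
  "rees_map n t = subst (\<lambda>v. case v of X i \<Rightarrow> xvar n i | Y j \<Rightarrow> path_gen n t j * Var Z | Z \<Rightarrow> 0)"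

definition rees_ideal :: "nat \<Rightarrow> nat \<Rightarrow> 'a::comm_ring_1 mpol set" where
  "rees_ideal n t = a_kernel (ring_T n) (rees_algebra n t) (rees_map n t)"

definition f_gen :: "nat \<Rightarrow> nat \<Rightarrow> 'a::comm_ring_1 mpol" where
  "f_gen n j = xvar n (n div 2 + j) * yvar n j - xvar n j * yvar n (j + 1)"

definition h_gen :: "nat \<Rightarrow> nat \<Rightarrow> 'a::comm_ring_1 mpol" where
  "h_gen n l = yvar n l * yvar n (l + n div 2) - yvar n 0 * yvar n (n div 2)"

definition ideal_L :: "nat \<Rightarrow> 'a::comm_ring_1 mpol set" where
  "ideal_L n = genideal (ring_T n) (f_gen n ` {1..n})"

definition ideal_H :: "nat \<Rightarrow> 'a::comm_ring_1 mpol set" where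
  "ideal_H n = genideal (ring_Ky n) (h_gen n ` {1..n div 2 - 1})"


subsection \<open>The structures and maps are the intended ones\<close>

lemma poly_ring_simps [simp]:
  "mult (poly_ring V) = (*)" "one (poly_ring V) = 1"
  "zero (poly_ring V) = 0" "add (poly_ring V) = (+)"
  by (simp_all add: poly_ring_def)

lemma keys_add_nat:
  "Poly_Mapping.keys (a + b) = Poly_Mapping.keys a \<union> Poly_Mapping.keys b" for a b :: "var \<Rightarrow>\<^sub>0 nat"
  by (auto simp: in_keys_iff lookup_add)

lemma cring_poly_ring: "cring (poly_ring V :: 'a::comm_ring_1 mpol ring)"
proof (rule cringI)
  show "abelian_group (poly_ring V :: 'a mpol ring)"
  proof (rule abelian_groupI)
    fix p :: "'a mpol" assume "p \<in> carrier (poly_ring V)"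
    then have "- p \<in> carrier (poly_ring V)"
      by (simp add: poly_ring_def in_keys_iff)
    then show "\<exists>q\<in>carrier (poly_ring V). q \<oplus>\<^bsub>poly_ring V\<^esub> p = \<zero>\<^bsub>poly_ring V\<^esub>"
      by (intro bexI[of _ "- p"]) auto
  next
    fix p q :: "'a mpol" assume "p \<in> carrier (poly_ring V)" "q \<in> carrier (poly_ring V)"
    then show "p \<oplus>\<^bsub>poly_ring V\<^esub> q \<in> carrier (poly_ring V)"
      using keys_add[of p q] by (auto simp: poly_ring_def)
  qed (auto simp: poly_ring_def algebra_simps)
  have "p * q \<in> carrier (poly_ring V)"
    if "p \<in> carrier (poly_ring V)" "q \<in> carrier (poly_ring V)" for p q :: "'a mpol"
  proof -
    have "Poly_Mapping.keys m \<subseteq> V" if m: "m \<in> Poly_Mapping.keys (p * q)" for m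
    proof -
      obtain a b where "m = a + b" "a \<in> Poly_Mapping.keys p" "b \<in> Poly_Mapping.keys q"
        using m keys_mult[of p q] by blast
      with \<open>p \<in> _\<close> \<open>q \<in> _\<close> show ?thesis
        by (auto simp: poly_ring_def keys_add_nat)
    qed
    then show ?thesis by (auto simp: poly_ring_def)
  qed
  then show "Group.comm_monoid (poly_ring V :: 'a mpol ring)"
    by (intro comm_monoidI) (auto simp: algebra_simps, simp add: poly_ring_def)
qed (auto simp: algebra_simps)

lemma subst_superset:
  assumes "finite A" "Poly_Mapping.keys p \<subseteq> A"
  shows "subst g p = (\<Sum>m\<in>A. Const (Poly_Mapping.lookup p m) * subst_mono g m)"
  unfolding subst_def using assms
  by (intro sum.mono_neutral_left) (auto simp: in_keys_iff Const_def)

lemma subst_add: "subst g (p + q) = subst g p + subst g q"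
proof -
  let ?A = "Poly_Mapping.keys p \<union> Poly_Mapping.keys q"
  have "finite ?A" by simp
  then show ?thesis
    using keys_add[of p q]
    by (simp add: subst_superset[of ?A] lookup_add Const_def single_add distrib_right sum.distrib)
qed

lemma subst_mono_superset:
  assumes "finite A" "Poly_Mapping.keys m \<subseteq> A"
  shows "subst_mono g m = (\<Prod>v\<in>A. g v ^ Poly_Mapping.lookup m v)"
  unfolding subst_mono_def using assms
  by (intro prod.mono_neutral_left) (auto simp: in_keys_iff)

lemma subst_mono_add: "subst_mono g (a + b) = subst_mono g a * subst_mono g b"
proof -
  let ?A = "Poly_Mapping.keys a \<union> Poly_Mapping.keys b"
  have "finite ?A" by simp
  then show ?thesis
    by (simp add: subst_mono_superset[of ?A] keys_add_nat lookup_add power_add prod.distrib)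
qed

lemma subst_0 [simp]: "subst g 0 = 0"
  by (simp add: subst_def)

lemma subst_single: "subst g (Poly_Mapping.single m c) = Const c * subst_mono g m"
  by (cases "c = 0") (auto simp: subst_def Const_def)

lemma subst_sum: "subst g (sum F A) = (\<Sum>i\<in>A. subst g (F i))"
  by (induction A rule: infinite_finite_induct) (auto simp: subst_add)

lemma mpol_decomp:
  "(\<Sum>m\<in>Poly_Mapping.keys p. Poly_Mapping.single m (Poly_Mapping.lookup p m)) = p"
  by (rule poly_mapping_eqI) (auto simp: lookup_sum lookup_single when_def in_keys_iff)

lemma subst_mult: "subst g (p * q) = subst g p * subst g q"
proof -
  let ?s = "\<lambda>p m. Poly_Mapping.single m (Poly_Mapping.lookup p m)"
  have 1: "subst g (Poly_Mapping.single a c * Poly_Mapping.single b d) =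
      subst g (Poly_Mapping.single a c) * subst g (Poly_Mapping.single b d)" for a b c d
  proof -
    have "Const (c * d) = Const c * Const d"
      by (simp add: Const_def mult_single)
    then show ?thesis
      by (simp add: mult_single subst_single subst_mono_add mult_ac)
  qed
  have "subst g (sum (?s p) (Poly_Mapping.keys p) * sum (?s q) (Poly_Mapping.keys q)) =
      subst g (sum (?s p) (Poly_Mapping.keys p)) * subst g (sum (?s q) (Poly_Mapping.keys q))"
    by (simp only: sum_product subst_sum 1)
  then show ?thesis by (simp only: mpol_decomp)
qed

lemma subst_Const: "subst g (Const c) = Const c"
  by (simp add: Const_def subst_single subst_mono_def mult_single)

lemma subst_1: "subst g 1 = 1"
  using subst_Const[of g 1] by (simp add: Const_def)

lemma subst_Var: "subst g (Var v) = g v"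
  by (simp add: Var_def subst_single subst_mono_def Const_def)

lemma subst_power: "subst g (p ^ k) = subst g p ^ k"
  by (induction k) (auto simp: subst_1 subst_mult)

lemma subst_prod: "subst g (prod F A) = (\<Prod>i\<in>A. subst g (F i))"
  by (induction A rule: infinite_finite_induct) (auto simp: subst_1 subst_mult)

lemma rees_map_Const: "rees_map n t (Const c) = Const c"
  by (simp add: rees_map_def subst_Const)

lemma rees_map_xvar: "rees_map n t (xvar n i) = xvar n i"
  by (simp add: rees_map_def xvar_def subst_Var)

lemma path_gen_mod: "path_gen n t (j mod n) = path_gen n t j"
  by (simp add: path_gen_def xvar_def mod_add_left_eq)

lemma rees_map_yvar: "rees_map n t (yvar n j) = path_gen n t j * Var Z"
  by (simp add: rees_map_def yvar_def subst_Var path_gen_mod)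

lemma Var_mem: "v \<in> V \<Longrightarrow> Var v \<in> carrier (poly_ring V)"
  by (auto simp: Var_def poly_ring_def)

lemma Const_mem: "Const c \<in> carrier (poly_ring V)"
  by (auto simp: Const_def poly_ring_def)

lemma sum_mem_poly_ring:
  assumes "\<And>i. i \<in> A \<Longrightarrow> F i \<in> carrier (poly_ring V)"
  shows "sum F A \<in> carrier (poly_ring V)"
proof -
  interpret cring "poly_ring V" by (rule cring_poly_ring)
  show ?thesis using assms
    using a_closed zero_closed by (induction A rule: infinite_finite_induct) auto
qed

lemma prod_mem_poly_ring:
  assumes "\<And>i. i \<in> A \<Longrightarrow> F i \<in> carrier (poly_ring V)"
  shows "prod F A \<in> carrier (poly_ring V)"
proof -
  interpret cring "poly_ring V" by (rule cring_poly_ring)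
  show ?thesis using assms
    using m_closed one_closed by (induction A rule: infinite_finite_induct) auto
qed

lemma rees_gens_subset:
  "carrier (ring_S n) \<union> (\<lambda>j. path_gen n t j * Var Z) ` {1..n}
    \<subseteq> (carrier (ring_Ss n) :: 'a::comm_ring_1 mpol set)"
proof -
  interpret cring "ring_Ss n :: 'a mpol ring" unfolding ring_Ss_def by (rule cring_poly_ring)
  have "path_gen n t j * Var Z \<in> (carrier (ring_Ss n) :: 'a mpol set)" if "j \<in> {1..n}" for j
  proof -
    have "path_gen n t j \<in> (carrier (ring_Ss n) :: 'a mpol set)"
      "Var Z \<in> (carrier (ring_Ss n) :: 'a mpol set)"
      unfolding path_gen_def ring_Ss_def xvar_def using that
      by (auto intro!: prod_mem_poly_ring Var_mem)
    then show ?thesis using m_closed by (simp add: ring_Ss_def)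
  qed
  moreover have "carrier (ring_S n) \<subseteq> (carrier (ring_Ss n) :: 'a mpol set)"
    by (auto simp: ring_S_def ring_Ss_def poly_ring_def)
  ultimately show ?thesis by blast
qed

lemma cring_rees_algebra: "cring (rees_algebra n t)"
proof -
  interpret cring "ring_Ss n" unfolding ring_Ss_def by (rule cring_poly_ring)
  show ?thesis unfolding rees_algebra_def
    using subcring_iff[OF generate_ring_incl[OF rees_gens_subset]]
      subcringI'[OF generate_ring_is_subring[OF rees_gens_subset]] by blast
qed

lemma rees_algebra_simps [simp]:
  "mult (rees_algebra n t) = (*)" "one (rees_algebra n t) = 1"
  "zero (rees_algebra n t) = 0" "add (rees_algebra n t) = (+)"
  by (simp_all add: rees_algebra_def ring_Ss_def)

lemma sum_mem_rees:
  assumes "\<And>i. i \<in> A \<Longrightarrow> F i \<in> carrier (rees_algebra n t)"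
  shows "sum F A \<in> carrier (rees_algebra n t)"
proof -
  interpret cring "rees_algebra n t" by (rule cring_rees_algebra)
  show ?thesis using assms
    using a_closed zero_closed by (induction A rule: infinite_finite_induct) auto
qed

lemma prod_mem_rees:
  assumes "\<And>i. i \<in> A \<Longrightarrow> F i \<in> carrier (rees_algebra n t)"
  shows "prod F A \<in> carrier (rees_algebra n t)"
proof -
  interpret cring "rees_algebra n t" by (rule cring_rees_algebra)
  show ?thesis using assms
    using m_closed one_closed by (induction A rule: infinite_finite_induct) auto
qed

lemma rees_map_hom:
  "(rees_map n t :: 'a::comm_ring_1 mpol \<Rightarrow> _) \<in> ring_hom (ring_T n) (rees_algebra n t)"
proof (rule ring_hom_memI)
  interpret R: cring "rees_algebra n t :: 'a mpol ring" by (rule cring_rees_algebra)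
  have S: "p \<in> carrier (rees_algebra n t)" if "p \<in> carrier (ring_S n)" for p :: "'a mpol"
    using that by (auto simp: rees_algebra_def intro: generate_ring.incl)
  have U: "path_gen n t j * Var Z \<in> (carrier (rees_algebra n t) :: 'a mpol set)" if "j < n" for j
  proof (cases "j = 0")
    case True
    then show ?thesis using that path_gen_mod[of n t n, where 'a = 'a]
      by (auto simp: rees_algebra_def intro!: generate_ring.incl rev_image_eqI[of n])
  next
    case False
    then show ?thesis using that
      by (auto simp: rees_algebra_def intro!: generate_ring.incl)
  qed
  have pow: "q ^ k \<in> carrier (rees_algebra n t)" if "q \<in> carrier (rees_algebra n t)"
    for q :: "'a mpol" and k
    using prod_mem_rees[of "{..<k}" "\<lambda>_. q"] that by simp
  fix p :: "'a mpol" assume p: "p \<in> carrier (ring_T n)"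
  show "rees_map n t p \<in> carrier (rees_algebra n t)"
    unfolding rees_map_def subst_def
  proof (rule sum_mem_rees)
    fix m assume m: "m \<in> Poly_Mapping.keys p"
    let ?g = "\<lambda>v. case v of X i \<Rightarrow> xvar n i | Y j \<Rightarrow> path_gen n t j * Var Z | Z \<Rightarrow> (0 :: 'a mpol)"
    have "subst_mono ?g m \<in> carrier (rees_algebra n t)"
      unfolding subst_mono_def
    proof (intro prod_mem_rees pow)
      fix v assume "v \<in> Poly_Mapping.keys m"
      with p m have "v \<in> X ` {..<n} \<union> Y ` {..<n}"
        by (auto simp: ring_T_def poly_ring_def)
      then show "?g v \<in> carrier (rees_algebra n t)"
        using S by (auto intro!: U simp: ring_S_def xvar_def Var_mem)
    qed
    moreover have "Const (Poly_Mapping.lookup p m) \<in> carrier (rees_algebra n t)"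
      by (intro S) (simp add: ring_S_def Const_mem)
    ultimately show "Const (Poly_Mapping.lookup p m) * subst_mono ?g m \<in> carrier (rees_algebra n t)"
      using R.m_closed by simp
  qed
qed (auto simp: rees_map_def ring_T_def subst_add subst_mult subst_1)

lemma rees_map_surj:
  "rees_map n t ` carrier (ring_T n) = (carrier (rees_algebra n t) :: 'a::comm_ring_1 mpol set)"
proof
  show "rees_map n t ` carrier (ring_T n) \<subseteq> (carrier (rees_algebra n t) :: 'a mpol set)"
    using ring_hom_closed[OF rees_map_hom] by auto
  interpret T: cring "ring_T n :: 'a mpol ring" unfolding ring_T_def by (rule cring_poly_ring)
  interpret Ss: cring "ring_Ss n :: 'a mpol ring" unfolding ring_Ss_def by (rule cring_poly_ring)
  interpret R: cring "rees_algebra n t :: 'a mpol ring" by (rule cring_rees_algebra)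
  have im: "subring (rees_map n t ` carrier (ring_T n)) (rees_algebra n t :: 'a mpol ring)"
    by (rule ring_hom_ring.img_is_subring[OF ring_hom_ringI2 T.carrier_is_subring])
       (rule T.ring_axioms R.ring_axioms rees_map_hom)+
  have gen: "p \<in> rees_map n t ` carrier (ring_T n)"
    if "p \<in> carrier (ring_S n) \<union> (\<lambda>j. path_gen n t j * Var Z) ` {1..n}" for p :: "'a mpol"
    using that
  proof
    assume p: "p \<in> carrier (ring_S n)"
    have "rees_map n t p = p"
    proof -
      have "rees_map n t p = (\<Sum>m\<in>Poly_Mapping.keys p. Const (Poly_Mapping.lookup p m) * subst_mono Var m)"
        unfolding rees_map_def subst_def subst_mono_def
        using p by (intro sum.cong refl arg_cong2[of _ _ _ _ "(*)"] prod.cong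
            arg_cong2[of _ _ _ _ "(^)"])
          (force simp: ring_S_def poly_ring_def xvar_def)
      also have "\<dots> = (\<Sum>m\<in>Poly_Mapping.keys p. Poly_Mapping.single m (Poly_Mapping.lookup p m))"
      proof (intro sum.cong refl)
        fix m :: "var \<Rightarrow>\<^sub>0 nat"
        have pow: "(Var v :: 'a mpol) ^ k = Poly_Mapping.single (Poly_Mapping.single v k) 1" for v k
          by (induction k) (auto simp: Var_def mult_single simp flip: single_add)
        have pr: "(\<Prod>v\<in>A. Poly_Mapping.single (F v) (1::'a)) = Poly_Mapping.single (sum F A) 1"
          if "finite A" for A and F :: "var \<Rightarrow> var \<Rightarrow>\<^sub>0 nat"
          using that by (induction A rule: finite_induct) (auto simp: mult_single)
        have "(\<Sum>v\<in>Poly_Mapping.keys m. Poly_Mapping.single v (Poly_Mapping.lookup m v)) = m"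
          by (rule poly_mapping_eqI) (auto simp: lookup_sum lookup_single when_def in_keys_iff)
        then show "Const (Poly_Mapping.lookup p m) * subst_mono Var m
            = Poly_Mapping.single m (Poly_Mapping.lookup p m)"
          by (simp add: subst_mono_def pow pr Const_def mult_single)
      qed
      also have "\<dots> = p" by (rule mpol_decomp)
      finally show ?thesis .
    qed
    moreover have "p \<in> carrier (ring_T n)"
      using p by (auto simp: ring_S_def ring_T_def poly_ring_def)
    ultimately show ?thesis by force
  next
    assume "p \<in> (\<lambda>j. path_gen n t j * Var Z) ` {1..n}"
    then obtain j where j: "j \<in> {1..n}" "p = rees_map n t (yvar n j)"
      by (auto simp: rees_map_yvar)
    moreover have "yvar n j \<in> carrier (ring_T n)"
      using j by (auto simp: yvar_def ring_T_def intro!: Var_mem)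
    ultimately show ?thesis by blast
  qed
  show "(carrier (rees_algebra n t) :: 'a mpol set) \<subseteq> rees_map n t ` carrier (ring_T n)"
  proof
    fix p assume "p \<in> carrier (rees_algebra n t :: 'a mpol ring)"
    then have "p \<in> generate_ring (ring_Ss n)
        (carrier (ring_S n) \<union> (\<lambda>j. path_gen n t j * Var Z) ` {1..n})"
      by (simp add: rees_algebra_def)
    then show "p \<in> rees_map n t ` carrier (ring_T n)"
    proof (induction rule: generate_ring.induct)
      case one
      show ?case using subringE(3)[OF im] by (simp add: ring_Ss_def)
    next
      case (incl q)
      then show ?case by (rule gen)
    next
      case (a_inv q)
      have c: "q \<in> carrier (rees_algebra n t)" using a_inv(1) by (simp add: rees_algebra_def)
      have c': "q \<in> carrier (ring_Ss n)"
        using Ss.generate_ring_in_carrier[OF rees_gens_subset a_inv(1)] .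
      have "\<ominus>\<^bsub>ring_Ss n\<^esub> q = - q"
        using Ss.l_neg[OF c'] by (simp add: ring_Ss_def eq_neg_iff_add_eq_0)
      moreover have "\<ominus>\<^bsub>rees_algebra n t\<^esub> q = - q"
        using R.l_neg[OF c] by (simp add: eq_neg_iff_add_eq_0)
      ultimately show ?case using subringE(5)[OF im a_inv(2)] by simp
    next
      case (eng_add a b)
      then show ?case using subringE(7)[OF im] by (simp add: ring_Ss_def)
    next
      case (eng_mult a b)
      then show ?case using subringE(6)[OF im] by (simp add: ring_Ss_def)
    qed
  qed
qed

end

theory Submission
  imports Defs
begin

text \<open>
  Put \<open>n = 2m\<close>. The map \<open>\<phi>\<close> sends monomials to monomials, so \<open>J\<close> is spanned by the differences
  of monomials with the same image (\<open>rees_ideal_subset_if_binomials\<close>). Call two monomials of \<open>T\<close>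
  linked if finitely many exchanges \<open>x\<^sub>j\<^sub>+\<^sub>m y\<^sub>j \<leftrightarrow> x\<^sub>j y\<^sub>j\<^sub>+\<^sub>1\<close> and
  \<open>y\<^sub>l y\<^sub>l\<^sub>+\<^sub>m \<leftrightarrow> y\<^sub>0 y\<^sub>m\<close> lead from one to the other. Linked monomials are congruent modulo
  \<open>L + HT\<close>, and \<open>L + HT \<subseteq> J\<close> because each exchange preserves the image: both
  \<open>x\<^sub>j\<^sub>+\<^sub>m u\<^sub>j\<close> and \<open>x\<^sub>j u\<^sub>j\<^sub>+\<^sub>1\<close> are the product of the \<open>m + 1\<close> variables
  \<open>x\<^sub>j, \<dots>, x\<^sub>j\<^sub>+\<^sub>m\<close>, and \<open>u\<^sub>l u\<^sub>l\<^sub>+\<^sub>m\<close> is the product of all \<open>n\<close> of them. It remains to show that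
  two monomials with the same image are linked (\<open>same_image_imp_linked\<close>).

  This goes by induction on the degree. Exchanges preserve the degree and the image, and a
  common variable can be cancelled, so it suffices to link two distinct monomials
  \<open>x\<^sup>a y\<^sup>b\<close> and \<open>x\<^sup>c y\<^sup>e\<close> with the same image to monomials that share a variable
  (\<open>linked_common_variable\<close>). Let \<open>B\<^sub>i = b\<^sub>i\<^sub>-\<^sub>m\<^sub>+\<^sub>1 + \<dots> + b\<^sub>i\<close>, and \<open>E\<^sub>i\<close> likewise for \<open>e\<close>.
  Equality of the images says that \<open>a\<^sub>i + B\<^sub>i = c\<^sub>i + E\<^sub>i\<close> for all \<open>i\<close> and that \<open>b\<close> and \<open>e\<close> have the
  same sum. Put \<open>D\<^sub>i = c\<^sub>i - a\<^sub>i = B\<^sub>i - E\<^sub>i\<close> and \<open>g\<^sub>i = b\<^sub>i - e\<^sub>i\<close>. Since \<open>B\<^sub>i + B\<^sub>i\<^sub>+\<^sub>m\<close> is the sum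
  of all the \<open>b\<^sub>j\<close>, one gets \<open>D\<^sub>i\<^sub>+\<^sub>m = - D\<^sub>i\<close>; comparing consecutive windows gives
  \<open>D\<^sub>i\<^sub>+\<^sub>1 - D\<^sub>i = g\<^sub>i\<^sub>+\<^sub>1 - g\<^sub>i\<^sub>+\<^sub>1\<^sub>+\<^sub>m\<close>. By \<open>antiperiodic_sign_change\<close> one of three cases occurs.

  \<^item> \<open>D\<^sub>j > 0\<close> and \<open>b\<^sub>j > 0\<close> for some \<open>j\<close>. Then \<open>D\<^sub>j\<^sub>+\<^sub>m < 0\<close>, so \<open>a\<^sub>j\<^sub>+\<^sub>m > 0\<close>; the exchange of
    \<open>x\<^sub>j\<^sub>+\<^sub>m y\<^sub>j\<close> for \<open>x\<^sub>j y\<^sub>j\<^sub>+\<^sub>1\<close> in the first monomial creates \<open>x\<^sub>j\<close>, which divides the second.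
  \<^item> \<open>D\<^sub>j < 0\<close> and \<open>e\<^sub>j > 0\<close> for some \<open>j\<close>: the same with the two monomials interchanged.
  \<^item> \<open>D = 0\<close>. Then \<open>a = c\<close> and \<open>g\<close> has period \<open>m\<close>, sum \<open>0\<close>, and is not \<open>0\<close>. Choose \<open>g\<^sub>i > 0 > g\<^sub>j\<close>;
    then \<open>y\<^sub>i y\<^sub>i\<^sub>+\<^sub>m\<close> divides the first monomial and can be exchanged for \<open>y\<^sub>j y\<^sub>j\<^sub>+\<^sub>m\<close>, while \<open>y\<^sub>j\<close>
    divides the second.
\<close>

section \<open>Periodic sequences\<close>

lemma (in comm_monoid_set) periodic_window:
  fixes g :: "nat \<Rightarrow> 'a"
  assumes "\<And>i. g (i + n) = g i"
  shows "F (\<lambda>r. g (i + r)) {..<n} = F g {..<n}"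
proof (cases n)
  case (Suc k)
  show ?thesis
  proof (induction i)
    case (Suc i)
    have "F (\<lambda>r. g (Suc i + r)) {..<n} = F (\<lambda>r. g (i + Suc r)) {..<k} \<^bold>* g (i + n)"
      by (simp add: \<open>n = Suc k\<close> commute)
    also have "\<dots> = F (\<lambda>r. g (i + Suc r)) {..<k} \<^bold>* g i"
      unfolding assms ..
    also have "\<dots> = F (\<lambda>r. g (i + r)) {..<n}"
      unfolding \<open>n = Suc k\<close> by (simp add: lessThan_Suc_shift commute del: lessThan_Suc)
    finally show ?case using Suc by simp
  qed simp
qed simp

lemma (in comm_monoid_set) window_append:
  fixes g :: "nat \<Rightarrow> 'a"
  shows "F g {..<m + k} = F g {..<m} \<^bold>* F (\<lambda>r. g (m + r)) {..<k}"
  by (induction k) (simp_all add: ac_simps)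

text \<open>
  The number \<open>W i\<close> is the sum of \<open>b\<close> over the cyclic window from \<open>i - m + 1\<close> to \<open>i\<close>, shifted by
  the period \<open>2 * m\<close> to keep the indices natural: the contribution of the \<open>y\<close>-part of a
  monomial to the exponent of \<open>x\<^sub>i\<close> in its image. Opposite windows partition one period, and
  consecutive windows differ by the terms at their ends.
\<close>

lemma periodic_half_windows:
  fixes b :: "nat \<Rightarrow> nat"
  assumes "\<And>i. b (i + 2 * m) = b i"
  defines "W \<equiv> \<lambda>i. \<Sum>r<m. b (i + m + 1 + r)"
  shows "W i + W (i + m) = (\<Sum>r<2 * m. b r)"
    and "W (i + 1) + b (i + 1 + m) = W i + b (i + 1)"
proof -
  have "W (i + m) = (\<Sum>r<m. b (i + 1 + r))"
    unfolding W_def using assms(1)[of "i + 1 + _"]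
    by (intro sum.cong refl) (metis (no_types, lifting) add.assoc add.commute mult_2)
  then have "W i + W (i + m) = (\<Sum>r<m + m. b (i + 1 + r))"
    unfolding sum.window_append W_def by (simp add: add_ac)
  also have "\<dots> = (\<Sum>r<2 * m. b r)"
    using sum.periodic_window[of b "2 * m" "i + 1"] assms(1) by (simp add: mult_2)
  finally show "W i + W (i + m) = (\<Sum>r<2 * m. b r)" .
  have "W (i + 1) + b (i + 1 + m) = (\<Sum>r<Suc m. b (i + m + 1 + r))"
    unfolding W_def by (subst sum.lessThan_Suc_shift) (simp add: add_ac)
  also have "\<dots> = W i + b (i + 1 + 2 * m)"
    by (simp add: W_def mult_2 add_ac)
  finally show "W (i + 1) + b (i + 1 + m) = W i + b (i + 1)"
    unfolding assms(1) .
qed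

lemma sum_eq_imp_greater:
  fixes f g :: "'b \<Rightarrow> nat"
  assumes "finite A" "sum f A = sum g A" "i \<in> A" "f i \<noteq> g i"
  shows "\<exists>j\<in>A. g j < f j"
  using sum_mono_inv[OF assms(2) _ assms(3,1)] assms(4) by (meson not_less)

text \<open>
  Suppose that \<open>b j = 0\<close> wherever \<open>D j > 0\<close> and \<open>e j = 0\<close> wherever \<open>D j < 0\<close>. If
  \<open>D (i + 1) > 0\<close>, then \<open>D (i + 1 + m) < 0\<close>, so both positive terms of the increment vanish and
  \<open>D i \<ge> D (i + 1) > 0\<close>. Hence \<open>D\<close> never becomes positive after a value \<open>\<le> 0\<close>. Such a value
  exists because \<open>D\<close> changes sign after \<open>m\<close> steps, and for the same reason \<open>D\<close> cannot stay
  \<open>\<le> 0\<close> without vanishing.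
\<close>

lemma antiperiodic_sign_change:
  fixes D :: "nat \<Rightarrow> int" and b e :: "nat \<Rightarrow> nat"
  assumes "m > 0"
    and anti: "\<And>i. D (i + m) = - D i"
    and step: "\<And>i. D (i + 1) - D i = (int (b (i + 1)) - int (b (i + 1 + m))) - (int (e (i + 1)) - int (e (i + 1 + m)))"
  shows "(\<exists>j. D j > 0 \<and> b j > 0) \<or> (\<exists>j. D j < 0 \<and> e j > 0) \<or> (\<forall>j. D j = 0)"
proof (rule ccontr)
  assume contra: "\<not> ?thesis"
  from contra have b0: "b j = 0" if "D j > 0" for j using that by force
  have e0: "e j = 0" if "D j < 0" for j using that contra by force
  have keep: "D (i + 1) \<le> 0" if "D i \<le> 0" for i
  proof (rule ccontr)
    assume pos: "\<not> D (i + 1) \<le> 0"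
    then have "b (i + 1) = 0" "e (i + 1 + m) = 0"
      using b0[of "i + 1"] e0[of "i + 1 + m"] anti[of "i + 1"] by auto
    then show False using step[of i] that pos by simp
  qed
  obtain j0 where j0: "D j0 \<le> 0"
    using anti[of 0] by (metis linear neg_le_0_iff_le)
  have le: "D i \<le> 0" if "i \<ge> j0" for i
    using that by (induction i rule: dec_induct) (use j0 keep in auto)
  have ge0: "D i = 0" if "i \<ge> j0" for i
    using le[OF that] le[of "i + m"] anti[of i] that by simp
  \<comment> \<open>Each index can be moved past \<open>j0\<close> by multiples of \<open>m\<close>, which preserve \<open>\<bar>D\<bar>\<close>.\<close>
  have abs: "\<bar>D (i + r * m)\<bar> = \<bar>D i\<bar>" for i r
    by (induction r) (use anti in \<open>auto simp: algebra_simps\<close>, metis abs_minus add.commute add.left_commute)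
  have "D i = 0" for i
  proof -
    have "D (i + j0 * m) = 0" using \<open>m > 0\<close> by (intro ge0) (simp add: trans_le_add2)
    then show ?thesis using abs[of i j0] by simp
  qed
  then show False using contra by blast
qed

section \<open>Monomials and their images\<close>

type_synonym expo = "var \<Rightarrow>\<^sub>0 nat"

definition T_monos :: "nat \<Rightarrow> expo set" where
  "T_monos n = {k. Poly_Mapping.keys k \<subseteq> X ` {..<n} \<union> Y ` {..<n}}"

definition monomial :: "expo \<Rightarrow> 'a::comm_ring_1 mpol" where
  "monomial k = Poly_Mapping.single k 1"

definition x_exp :: "nat \<Rightarrow> nat \<Rightarrow> expo" where
  "x_exp n i = Poly_Mapping.single (X (i mod n)) 1"

definition y_exp :: "nat \<Rightarrow> nat \<Rightarrow> expo" where
  "y_exp n j = Poly_Mapping.single (Y (j mod n)) 1"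

text \<open>The exponent of the monomial \<open>\<phi>(x\<^sup>a y\<^sup>b)\<close> (see \<open>rees_map_monomial\<close>): each factor \<open>y\<^sub>j\<close>
  contributes \<open>u\<^sub>j s\<close>. It is given by linear formulas, so that single exponents can be read off.\<close>

definition image_exp :: "nat \<Rightarrow> nat \<Rightarrow> expo \<Rightarrow> expo" where
  "image_exp n t k =
     (\<Sum>i<n. Poly_Mapping.single (X i) (Poly_Mapping.lookup k (X i))) +
     (\<Sum>j<n. (\<Sum>i<t. Poly_Mapping.single (X ((j + i) mod n)) (Poly_Mapping.lookup k (Y j))) +
        Poly_Mapping.single Z (Poly_Mapping.lookup k (Y j)))"

lemma monomial_add: "monomial (k + l) = monomial k * monomial l"
  by (simp add: monomial_def mult_single)

lemma xvar_eq_monomial: "xvar n i = monomial (x_exp n i)"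
  by (simp add: xvar_def Var_def monomial_def x_exp_def)

lemma yvar_eq_monomial: "yvar n j = monomial (y_exp n j)"
  by (simp add: yvar_def Var_def monomial_def y_exp_def)

lemma T_monos_add: "k \<in> T_monos n \<Longrightarrow> l \<in> T_monos n \<Longrightarrow> k + l \<in> T_monos n"
  by (simp add: T_monos_def keys_add_nat)

lemma T_monos_summand: "k + l \<in> T_monos n \<Longrightarrow> k \<in> T_monos n \<and> l \<in> T_monos n"
  by (simp add: T_monos_def keys_add_nat)

lemma x_exp_T_monos: "n > 0 \<Longrightarrow> x_exp n i \<in> T_monos n"
  by (simp add: T_monos_def x_exp_def)

lemma y_exp_T_monos: "n > 0 \<Longrightarrow> y_exp n i \<in> T_monos n"
  by (simp add: T_monos_def y_exp_def)

lemma monomial_in_T: "k \<in> T_monos n \<Longrightarrow> monomial k \<in> carrier (ring_T n)"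
  by (auto simp: T_monos_def monomial_def ring_T_def poly_ring_def)

lemma T_monos_eqI:
  assumes "k \<in> T_monos n" "l \<in> T_monos n"
    and "\<And>i. i < n \<Longrightarrow> Poly_Mapping.lookup k (X i) = Poly_Mapping.lookup l (X i)"
    and "\<And>i. i < n \<Longrightarrow> Poly_Mapping.lookup k (Y i) = Poly_Mapping.lookup l (Y i)"
  shows "k = l"
proof (rule poly_mapping_eqI)
  fix v
  show "Poly_Mapping.lookup k v = Poly_Mapping.lookup l v"
  proof (cases "v \<in> X ` {..<n} \<union> Y ` {..<n}")
    case True
    then show ?thesis using assms(3,4) by auto
  next
    case False
    then have "v \<notin> Poly_Mapping.keys k" "v \<notin> Poly_Mapping.keys l"
      using assms(1,2) by (auto simp: T_monos_def)
    then show ?thesis by (simp add: in_keys_iff)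
  qed
qed

lemma image_exp_add: "image_exp n t (k + l) = image_exp n t k + image_exp n t l"
  by (simp add: image_exp_def lookup_add single_add sum.distrib algebra_simps)

lemma monomial_power: "monomial (Poly_Mapping.single v a) ^ b = monomial (Poly_Mapping.single v (a * b))"
  by (induction b) (auto simp: monomial_def mult_single simp flip: single_add)

lemma monomial_sum: "finite A \<Longrightarrow> (\<Prod>i\<in>A. monomial (F i)) = monomial (\<Sum>i\<in>A. F i)"
  by (induction A rule: finite_induct) (auto simp: monomial_add, simp add: monomial_def)

lemma rees_map_monomial:
  assumes "k \<in> T_monos n"
  shows "rees_map n t (monomial k :: 'a::comm_ring_1 mpol) = monomial (image_exp n t k)"
proof -
  let ?g = "\<lambda>v. case v of X i \<Rightarrow> xvar n i | Y j \<Rightarrow> path_gen n t j * Var Z | Z \<Rightarrow> (0 :: 'a mpol)"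
  let ?p = "\<lambda>v. ?g v ^ Poly_Mapping.lookup k v"
  have x: "?p (X i) = monomial (Poly_Mapping.single (X i) (Poly_Mapping.lookup k (X i)))"
    if "i < n" for i
    using that by (simp add: xvar_eq_monomial x_exp_def monomial_power)
  have y: "?p (Y j) = monomial ((\<Sum>i<t. Poly_Mapping.single (X ((j + i) mod n)) (Poly_Mapping.lookup k (Y j))) +
        Poly_Mapping.single Z (Poly_Mapping.lookup k (Y j)))" for j
  proof -
    let ?b = "Poly_Mapping.lookup k (Y j)"
    have Z: "Var Z ^ ?b = (monomial (Poly_Mapping.single Z ?b) :: 'a mpol)"
      using monomial_power[of Z 1 ?b] by (simp add: Var_def monomial_def)
    have "path_gen n t j ^ ?b = (\<Prod>i<t. monomial (Poly_Mapping.single (X ((j + i) mod n)) ?b) :: 'a mpol)"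
      by (simp add: path_gen_def prod_power_distrib xvar_eq_monomial x_exp_def monomial_power)
    then show ?thesis
      by (simp add: power_mult_distrib Z monomial_sum monomial_add)
  qed
  have "rees_map n t (monomial k) = subst_mono ?g k"
    by (simp add: rees_map_def monomial_def subst_single Const_def)
  also have "\<dots> = (\<Prod>v\<in>X ` {..<n} \<union> Y ` {..<n}. ?p v)"
    using assms by (intro subst_mono_superset) (auto simp: T_monos_def)
  also have "\<dots> = (\<Prod>i<n. ?p (X i)) * (\<Prod>j<n. ?p (Y j))"
    by (subst prod.union_disjoint) (auto simp: prod.reindex inj_on_def)
  also have "\<dots> = monomial (image_exp n t k)"
    using x y by (simp add: image_exp_def monomial_sum monomial_add prod.distrib sum.distrib del: var.case)
  finally show ?thesis .
qed

lemma rees_map_add: "rees_map n t (p + q) = rees_map n t p + rees_map n t q"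
  by (simp add: rees_map_def subst_add)

lemma rees_map_mult: "rees_map n t (p * q) = rees_map n t p * rees_map n t q"
  by (simp add: rees_map_def subst_mult)

lemma rees_map_diff: "rees_map n t (p - q) = rees_map n t p - rees_map n t q"
  using rees_map_add[of n t "p - q" q] by (simp add: algebra_simps)

lemma lookup_image_exp_Z:
  "Poly_Mapping.lookup (image_exp n t k) Z = (\<Sum>j<n. Poly_Mapping.lookup k (Y j))"
  by (simp add: image_exp_def lookup_add lookup_sum lookup_single)

text \<open>The variable \<open>x\<^sub>i\<close> divides \<open>u\<^sub>j\<close> exactly for \<open>j = i, i - 1, \<dots>, i - m + 1\<close> modulo \<open>2 * m\<close>. These
  are written in increasing order and shifted by the period to avoid subtraction.\<close>

lemma lookup_image_exp_X:
  assumes "i < 2 * m"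
  shows "Poly_Mapping.lookup (image_exp (2 * m) m k) (X i) = Poly_Mapping.lookup k (X i) +
     (\<Sum>r<m. Poly_Mapping.lookup k (Y ((i + m + 1 + r) mod (2 * m))))"
proof -
  let ?n = "2 * m"
  let ?b = "\<lambda>j. Poly_Mapping.lookup k (Y j)"
  have x: "(\<Sum>i'<?n. Poly_Mapping.lookup k (X i') when i' = i) = Poly_Mapping.lookup k (X i)"
    using assms by (simp add: when_def)
  have "(\<Sum>j<?n. \<Sum>r<m. ?b j when X ((j + r) mod ?n) = X i) =
      (\<Sum>r<m. \<Sum>j<?n. ?b j when (j + r) mod ?n = i)"
    by (subst sum.swap) simp
  also have "\<dots> = (\<Sum>r<m. ?b ((i + ?n - r) mod ?n))"
  proof (rule sum.cong[OF refl])
    fix r assume r: "r \<in> {..<m}"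
    have "(j + r) mod ?n = i \<longleftrightarrow> j = (i + ?n - r) mod ?n" if "j < ?n" for j
      using that r assms by (auto simp: mod_if)
    then have "(\<Sum>j<?n. ?b j when (j + r) mod ?n = i) =
        (\<Sum>j<?n. if j = (i + ?n - r) mod ?n then ?b j else 0)"
      by (intro sum.cong) (auto simp: when_def)
    also have "\<dots> = ?b ((i + ?n - r) mod ?n)"
      using assms by simp
    finally show "(\<Sum>j<?n. ?b j when (j + r) mod ?n = i) = ?b ((i + ?n - r) mod ?n)" .
  qed
  also have "\<dots> = (\<Sum>r<m. ?b ((i + m + 1 + r) mod ?n))"
    by (rule sum.reindex_bij_witness[where i = "\<lambda>r. m - 1 - r" and j = "\<lambda>r. m - 1 - r"])
      (auto intro!: arg_cong[where f = "\<lambda>s. ?b (s mod ?n)"])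
  finally show ?thesis
    by (simp add: image_exp_def lookup_add lookup_sum lookup_single x)
qed

section \<open>Monomials congruent modulo the proposed generators\<close>

text \<open>
  The congruence generated by the two kinds of exchange that the generators of \<open>L\<close> and \<open>H\<close>
  express. It is stated for exponents, so that invariance of the degree and membership in an
  ideal both follow by rule induction.
\<close>

inductive linked :: "nat \<Rightarrow> expo \<Rightarrow> expo \<Rightarrow> bool" for m where
  exchange: "linked m (x_exp (2 * m) (j + m) + y_exp (2 * m) j)
                      (x_exp (2 * m) j + y_exp (2 * m) (j + 1))"
| antipodal: "linked m (y_exp (2 * m) l + y_exp (2 * m) (l + m)) (y_exp (2 * m) 0 + y_exp (2 * m) m)"
| reflexive: "linked m k k"
| symmetric: "linked m k l \<Longrightarrow> linked m l k"
| transitive: "linked m k l \<Longrightarrow> linked m l r \<Longrightarrow> linked m k r"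
| shift: "r \<in> T_monos (2 * m) \<Longrightarrow> linked m k l \<Longrightarrow> linked m (r + k) (r + l)"

lemma ideal_T_closed:
  assumes "ideal I (ring_T n :: 'a::comm_ring_1 mpol ring)"
  shows "p \<in> I \<Longrightarrow> q \<in> I \<Longrightarrow> p + q \<in> I"
    and "r \<in> carrier (ring_T n) \<Longrightarrow> p \<in> I \<Longrightarrow> r * p \<in> I"
    and "p \<in> I \<Longrightarrow> - p \<in> I"
    and "0 \<in> I"
proof -
  interpret ideal I "ring_T n" by fact
  show "p \<in> I \<Longrightarrow> q \<in> I \<Longrightarrow> p + q \<in> I"
    using additive_subgroup.a_closed[OF additive_subgroup_axioms, of p q] by (simp add: ring_T_def)
  show mult: "r \<in> carrier (ring_T n) \<Longrightarrow> p \<in> I \<Longrightarrow> r * p \<in> I" for r p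
    using I_l_closed[of p r] by (simp add: ring_T_def)
  have "- 1 = (Const (- 1) :: 'a mpol)"
    by (simp add: Const_def single_uminus)
  then have "- 1 \<in> (carrier (ring_T n) :: 'a mpol set)"
    by (simp add: ring_T_def Const_mem)
  then show "p \<in> I \<Longrightarrow> - p \<in> I"
    using mult[of "- 1" p] by simp
  show "0 \<in> I"
    using additive_subgroup.zero_closed[OF additive_subgroup_axioms] by (simp add: ring_T_def)
qed

lemma mod_representative:
  fixes j n :: nat
  assumes "n > 0"
  obtains j' where "j' \<in> {1..n}" "j' mod n = j mod n"
proof (cases "j mod n = 0")
  case True
  then show ?thesis using that[of n] assms by simp
next
  case False
  then show ?thesis using that[of "j mod n"] assms by (simp add: less_imp_le)
qed

lemma x_exp_cong: "i mod n = j mod n \<Longrightarrow> x_exp n i = x_exp n j"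
  by (simp add: x_exp_def)

lemma y_exp_cong: "i mod n = j mod n \<Longrightarrow> y_exp n i = y_exp n j"
  by (simp add: y_exp_def)

text \<open>
  The ideal is left arbitrary because the lemma is used twice: for \<open>L + HT\<close>, and for \<open>J\<close>, where
  it shows that linked monomials have the same image.
\<close>

lemma linked_imp_diff_in_ideal:
  assumes "linked m k l" and "m > 0"
    and I: "ideal I (ring_T (2 * m) :: 'a::comm_ring_1 mpol ring)"
    and f: "f_gen (2 * m) ` {1..2 * m} \<subseteq> I"
    and h: "h_gen (2 * m) ` {1..m - 1} \<subseteq> I"
  shows "monomial k - monomial l \<in> I"
  using assms(1)
proof induction
  case (exchange j)
  obtain j' where j': "j' \<in> {1..2 * m}" "j' mod (2 * m) = j mod (2 * m)"
    using mod_representative[of "2 * m" j] \<open>m > 0\<close> by auto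
  have "x_exp (2 * m) (m + j') = x_exp (2 * m) (j + m)" "y_exp (2 * m) j' = y_exp (2 * m) j"
    "x_exp (2 * m) j' = x_exp (2 * m) j" "y_exp (2 * m) (j' + 1) = y_exp (2 * m) (j + 1)"
    using j'(2) mod_add_cong[OF j'(2) HOL.refl[of "m mod (2 * m)"]]
      mod_add_cong[OF j'(2) HOL.refl[of "1 mod (2 * m)"]]
    by (auto intro!: x_exp_cong y_exp_cong simp: add.commute[of m])
  then have "f_gen (2 * m) j' = monomial (x_exp (2 * m) (j + m) + y_exp (2 * m) j) -
      (monomial (x_exp (2 * m) j + y_exp (2 * m) (j + 1)) :: 'a mpol)"
    by (simp add: f_gen_def xvar_eq_monomial yvar_eq_monomial monomial_add)
  then show ?case using f j'(1) by (metis image_subset_iff)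
next
  case (antipodal l)
  let ?Y = "y_exp (2 * m)"
  have base: "monomial (?Y s + ?Y (s + m)) - monomial (?Y 0 + ?Y m) \<in> I" if "s < m" for s
  proof (cases "s = 0")
    case True
    then show ?thesis using ideal_T_closed(4)[OF I] by simp
  next
    case False
    then have "h_gen (2 * m) s \<in> I" using h that by auto
    then show ?thesis by (simp add: h_gen_def yvar_eq_monomial monomial_add)
  qed
  \<comment> \<open>The exchange exists for every \<open>l\<close>, the generator \<open>h\<^sub>l\<close> only for \<open>0 < l < m\<close>; the product
    \<open>y\<^sub>l y\<^sub>l\<^sub>+\<^sub>m\<close> depends on \<open>l\<close> modulo \<open>m\<close> only, and \<open>base\<close> treats \<open>l = 0\<close> separately.\<close>
  have red: "?Y l + ?Y (l + m) = ?Y (l mod m) + ?Y (l mod m + m)"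
  proof -
    have "l mod (2 * m) = l mod m \<or> l mod (2 * m) = l mod m + m"
      using mod_mult2_eq[of l m 2] by (cases "l div m mod 2 = 0") (auto simp: mult.commute)
    then show ?thesis
    proof
      assume e: "l mod (2 * m) = l mod m"
      then have "?Y l = ?Y (l mod m)" "?Y (l + m) = ?Y (l mod m + m)"
        by (auto intro!: y_exp_cong simp flip: e simp: mod_add_left_eq)
      then show ?thesis by simp
    next
      assume e: "l mod (2 * m) = l mod m + m"
      have "?Y l = ?Y (l mod m + m)"
        by (rule y_exp_cong) (simp flip: e)
      moreover have "?Y (l + m) = ?Y (l mod m)"
      proof (rule y_exp_cong)
        have "(l + m) mod (2 * m) = (l mod (2 * m) + m) mod (2 * m)"
          by (simp add: mod_add_left_eq)
        also have "\<dots> = (l mod m + 2 * m) mod (2 * m)"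
          unfolding e by (simp add: mult_2 add.assoc)
        finally show "(l + m) mod (2 * m) = l mod m mod (2 * m)" by simp
      qed
      ultimately show ?thesis by (simp add: add.commute)
    qed
  qed
  show ?case unfolding red using base \<open>m > 0\<close> by simp
next
  case (reflexive k)
  then show ?case using ideal_T_closed(4)[OF I] by simp
next
  case (symmetric k l)
  then show ?case using ideal_T_closed(3)[OF I] by fastforce
next
  case (transitive k l r)
  then show ?case using ideal_T_closed(1)[OF I] by fastforce
next
  case (shift r k l)
  then show ?case using ideal_T_closed(2)[OF I monomial_in_T[OF shift(1)]]
    by (fastforce simp: monomial_add right_diff_distrib)
qed

definition T_degree :: "nat \<Rightarrow> expo \<Rightarrow> nat" where
  "T_degree n k = (\<Sum>i<n. Poly_Mapping.lookup k (X i) + Poly_Mapping.lookup k (Y i))"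

lemma T_degree_add: "T_degree n (k + l) = T_degree n k + T_degree n l"
  by (simp add: T_degree_def lookup_add sum.distrib)

lemma T_degree_x_exp: "n > 0 \<Longrightarrow> T_degree n (x_exp n i) = 1"
  by (simp add: T_degree_def x_exp_def lookup_single when_def)

lemma T_degree_y_exp: "n > 0 \<Longrightarrow> T_degree n (y_exp n i) = 1"
  by (simp add: T_degree_def y_exp_def lookup_single when_def)

lemma linked_T_monos: "linked m k l \<Longrightarrow> m > 0 \<Longrightarrow> k \<in> T_monos (2 * m) \<longleftrightarrow> l \<in> T_monos (2 * m)"
  by (induction rule: linked.induct)
    (auto simp: x_exp_T_monos y_exp_T_monos intro!: T_monos_add dest!: T_monos_summand)

lemma linked_T_degree: "linked m k l \<Longrightarrow> m > 0 \<Longrightarrow> T_degree (2 * m) k = T_degree (2 * m) l"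
  by (induction rule: linked.induct) (auto simp: T_degree_add T_degree_x_exp T_degree_y_exp)

section \<open>Monomials with the same image\<close>

lemma exp_split:
  assumes "Poly_Mapping.lookup k v > 0"
  obtains r where "k = Poly_Mapping.single v 1 + (r :: expo)"
proof
  show "k = Poly_Mapping.single v 1 + (k - Poly_Mapping.single v 1)"
    using assms by (intro poly_mapping_eqI) (auto simp: lookup_add lookup_minus lookup_single when_def)
qed


lemma x_exp_split:
  assumes "Poly_Mapping.lookup k (X (i mod n)) > 0"
  obtains r where "k = x_exp n i + r"
  using exp_split[OF assms] by (auto simp: x_exp_def)

lemma y_exp_split:
  assumes "Poly_Mapping.lookup k (Y (i mod n)) > 0"
  obtains r where "k = y_exp n i + r"
  using exp_split[OF assms] by (auto simp: y_exp_def)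

lemma linked_to_x:
  assumes "k \<in> T_monos (2 * m)"
    and "Poly_Mapping.lookup k (X ((j + m) mod (2 * m))) > 0"
    and "Poly_Mapping.lookup k (Y (j mod (2 * m))) > 0"
  obtains r where "linked m k (x_exp (2 * m) j + r)"
proof -
  obtain r1 where r1: "k = x_exp (2 * m) (j + m) + r1"
    using x_exp_split[OF assms(2)] by blast
  have "Poly_Mapping.lookup r1 (Y (j mod (2 * m))) > 0"
    using assms(3) by (simp add: r1 lookup_add x_exp_def lookup_single)
  then obtain r2 where r2: "r1 = y_exp (2 * m) j + r2"
    using y_exp_split by blast
  have "r2 \<in> T_monos (2 * m)"
    using assms(1) T_monos_summand unfolding r1 r2 by blast
  from linked.shift[OF this linked.exchange[of m j]]
  have "linked m k (x_exp (2 * m) j + (y_exp (2 * m) (j + 1) + r2))"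
    unfolding r1 r2 by (simp add: add_ac)
  then show ?thesis by (rule that)
qed

lemma linked_to_y:
  assumes "k \<in> T_monos (2 * m)" and "m > 0"
    and "Poly_Mapping.lookup k (Y (i mod (2 * m))) > 0"
    and "Poly_Mapping.lookup k (Y ((i + m) mod (2 * m))) > 0"
  obtains r where "linked m k (y_exp (2 * m) j + r)"
proof -
  obtain r1 where r1: "k = y_exp (2 * m) i + r1"
    using y_exp_split[OF assms(3)] by blast
  have "i mod (2 * m) \<noteq> (i + m) mod (2 * m)"
  proof -
    have "(i + m) mod (2 * m) = (i mod (2 * m) + m) mod (2 * m)"
      by (simp add: mod_add_left_eq)
    moreover have "r \<noteq> (r + m) mod (2 * m)" if "r < 2 * m" for r
      using that \<open>m > 0\<close> by (cases "r < m") (auto simp: mod_if[of "r + m"])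
    ultimately show ?thesis using \<open>m > 0\<close> by simp
  qed
  then have "Poly_Mapping.lookup r1 (Y ((i + m) mod (2 * m))) > 0"
    using assms(4) by (simp add: r1 lookup_add y_exp_def lookup_single)
  then obtain r2 where r2: "r1 = y_exp (2 * m) (i + m) + r2"
    using y_exp_split by blast
  have "r2 \<in> T_monos (2 * m)"
    using assms(1) T_monos_summand unfolding r1 r2 by blast
  from linked.shift[OF this linked.transitive[OF linked.antipodal[of m i]
        linked.symmetric[OF linked.antipodal[of m j]]]]
  have "linked m k (y_exp (2 * m) j + (y_exp (2 * m) (j + m) + r2))"
    unfolding r1 r2 by (simp add: add_ac)
  then show ?thesis by (rule that)
qed

text \<open>
  The heart of the induction. The three cases of the argument at the top are those of
  \<open>antiperiodic_sign_change\<close>, applied to the difference \<open>D\<close> of the \<open>x\<close>-exponents.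
\<close>

lemma linked_common_variable:
  assumes m: "m > 0" and k: "k \<in> T_monos (2 * m)" and l: "l \<in> T_monos (2 * m)"
    and image: "image_exp (2 * m) m k = image_exp (2 * m) m l" and "k \<noteq> l"
  obtains v r s where "linked m k (v + r)" "linked m l (v + s)" "T_degree (2 * m) v = 1"
proof -
  define n where "n = 2 * m"
  define a where "a i = Poly_Mapping.lookup k (X (i mod n))" for i
  define b where "b i = Poly_Mapping.lookup k (Y (i mod n))" for i
  define c where "c i = Poly_Mapping.lookup l (X (i mod n))" for i
  define e where "e i = Poly_Mapping.lookup l (Y (i mod n))" for i
  define D where "D i = int (c i) - int (a i)" for i
  have n: "n > 0" using m by (simp add: n_def)
  have b_per: "b (i + 2 * m) = b i" and e_per: "e (i + 2 * m) = e i" for i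
    by (simp_all add: b_def e_def n_def)
  have total: "(\<Sum>r<2 * m. b r) = (\<Sum>r<2 * m. e r)"
    using arg_cong[OF image, of "\<lambda>w. Poly_Mapping.lookup w Z"]
    by (simp add: lookup_image_exp_Z b_def e_def n_def)
  have balance: "a i + (\<Sum>r<m. b (i + m + 1 + r)) = c i + (\<Sum>r<m. e (i + m + 1 + r))" for i
  proof -
    have "(i mod n + m + 1 + r) mod n = (i + m + 1 + r) mod n" for r
      by (metis add.assoc mod_add_left_eq)
    then show ?thesis
      using arg_cong[OF image, of "\<lambda>w. Poly_Mapping.lookup w (X (i mod n))"]
        lookup_image_exp_X[of "i mod n" m] n
      by (simp only: n_def[symmetric] a_def b_def c_def e_def mod_less_divisor)
  qed
  have D: "D i = int (\<Sum>r<m. b (i + m + 1 + r)) - int (\<Sum>r<m. e (i + m + 1 + r))" for i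
    using balance[of i] unfolding D_def by linarith
  have anti: "D (i + m) = - D i" for i
    using periodic_half_windows(1)[of b m i, OF b_per] periodic_half_windows(1)[of e m i, OF e_per] total
    unfolding D by linarith
  have step: "D (i + 1) - D i =
      (int (b (i + 1)) - int (b (i + 1 + m))) - (int (e (i + 1)) - int (e (i + 1 + m)))" for i
    using periodic_half_windows(2)[of b m i, OF b_per] periodic_half_windows(2)[of e m i, OF e_per]
    unfolding D by linarith
  consider j where "D j > 0" "b j > 0" | j where "D j < 0" "e j > 0" | "\<forall>j. D j = 0"
    using antiperiodic_sign_change[OF m anti step] by blast
  then show thesis
  proof cases
    case 1
    have "a (j + m) > 0" using anti[of j] 1 by (simp add: D_def)
    then obtain r where "linked m k (x_exp (2 * m) j + r)"
      using linked_to_x[OF k, of j] 1 by (auto simp: a_def b_def n_def)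
    moreover have "c j > 0" using 1 by (simp add: D_def)
    then obtain s where "l = x_exp (2 * m) j + s"
      using x_exp_split[of l j "2 * m"] by (auto simp: c_def n_def)
    ultimately show thesis
      using that[of "x_exp (2 * m) j" r s] linked.reflexive m by (simp add: T_degree_x_exp)
  next
    case 2
    have "c (j + m) > 0" using anti[of j] 2 by (simp add: D_def)
    then obtain s where "linked m l (x_exp (2 * m) j + s)"
      using linked_to_x[OF l, of j] 2 by (auto simp: c_def e_def n_def)
    moreover have "a j > 0" using 2 by (simp add: D_def)
    then obtain r where "k = x_exp (2 * m) j + r"
      using x_exp_split[of k j "2 * m"] by (auto simp: a_def n_def)
    ultimately show thesis
      using that[of "x_exp (2 * m) j" r s] linked.reflexive m by (simp add: T_degree_x_exp)
  next
    case 3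
    have ne: "\<not> (\<forall>i<n. b i = e i)"
    proof
      assume "\<forall>i<n. b i = e i"
      moreover have "a i = c i" for i using 3 by (simp add: D_def)
      ultimately have "k = l"
        using k l unfolding n_def[symmetric]
        by (intro T_monos_eqI[of k n l]) (metis a_def b_def c_def e_def mod_less)+
      then show False using \<open>k \<noteq> l\<close> by simp
    qed
    obtain i where i: "i < n" "b i > e i"
      using sum_eq_imp_greater[of "{..<n}" b e] total ne unfolding n_def by auto
    obtain j where j: "j < n" "e j > b j"
      using sum_eq_imp_greater[of "{..<n}" e b] total ne unfolding n_def by (metis finite_lessThan lessThan_iff)
    \<comment> \<open>The increment of \<open>D\<close> at \<open>i\<close> relates the indices \<open>i\<close> and \<open>i + m\<close>; adding a period keeps
      the predecessor of \<open>i\<close> natural when \<open>i = 0\<close>.\<close>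
    have "Suc (i + m + 2 * m - 1) = i + m + 2 * m" "Suc (i + 2 * m - 1) = i + 2 * m"
      "i + 2 * m + m = i + m + 2 * m"
      using m by auto
    then have g: "int (b i) - int (e i) = int (b (i + m)) - int (e (i + m))"
      using step[of "i + 2 * m - 1"] 3 b_per[of i] e_per[of i] b_per[of "i + m"] e_per[of "i + m"]
      by (simp only: Suc_eq_plus1)
    obtain r where "linked m k (y_exp (2 * m) j + r)"
      using linked_to_y[OF k m, of i j] i g by (auto simp: b_def n_def)
    moreover obtain s where "l = y_exp (2 * m) j + s"
      using y_exp_split[of l j "2 * m"] j by (auto simp: e_def n_def)
    ultimately show thesis
      using that[of "y_exp (2 * m) j" r s] linked.reflexive m by (simp add: T_degree_y_exp)
  qed
qed

section \<open>The Rees ideal\<close>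

lemma mem_rees_ideal_iff:
  "p \<in> rees_ideal n t \<longleftrightarrow> p \<in> carrier (ring_T n) \<and> rees_map n t p = 0"
  by (simp add: rees_ideal_def a_kernel_def')

lemma cring_ring_T: "cring (ring_T n)"
  unfolding ring_T_def by (rule cring_poly_ring)

lemma ideal_rees_ideal: "ideal (rees_ideal n t) (ring_T n)"
  unfolding rees_ideal_def
  by (intro ring_hom_ring.kernel_is_ideal ring_hom_ringI2 cring.axioms(1) cring_ring_T
      cring_rees_algebra rees_map_hom)

lemma diff_in_poly_ring:
  "p \<in> carrier (poly_ring V) \<Longrightarrow> q \<in> carrier (poly_ring V) \<Longrightarrow> p - q \<in> carrier (poly_ring V)"
  using keys_diff[of p q] by (auto simp: poly_ring_def)

lemma mult_in_poly_ring:
  assumes "p \<in> carrier (poly_ring V)" "q \<in> carrier (poly_ring V)"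
  shows "p * q \<in> carrier (poly_ring V)"
  using cring.cring_simprules(5)[OF cring_poly_ring assms] by simp

lemma f_gen_in_rees_ideal:
  assumes "m > 0"
  shows "f_gen (2 * m) j \<in> (rees_ideal (2 * m) m :: 'a::comm_ring_1 mpol set)"
  unfolding mem_rees_ideal_iff
proof
  show "f_gen (2 * m) j \<in> (carrier (ring_T (2 * m)) :: 'a mpol set)"
    using assms unfolding f_gen_def ring_T_def xvar_def yvar_def
    by (intro diff_in_poly_ring mult_in_poly_ring Var_mem) auto
  have "xvar (2 * m) j * path_gen (2 * m) m (j + 1) =
      (\<Prod>i<Suc m. xvar (2 * m) (j + i) :: 'a mpol)"
    by (subst prod.lessThan_Suc_shift) (simp add: path_gen_def)
  also have "\<dots> = xvar (2 * m) (m + j) * path_gen (2 * m) m j"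
    by (simp add: path_gen_def mult.commute add.commute)
  finally have "xvar (2 * m) (m + j) * (path_gen (2 * m) m j * Var Z) =
      xvar (2 * m) j * (path_gen (2 * m) m (j + 1) * (Var Z :: 'a mpol))"
    by (simp only: mult.assoc[symmetric])
  then show "rees_map (2 * m) m (f_gen (2 * m) j :: 'a mpol) = 0"
    by (simp add: f_gen_def rees_map_diff rees_map_mult rees_map_xvar rees_map_yvar)
qed

lemma path_gen_antipodal:
  "path_gen (2 * m) m l * path_gen (2 * m) m (l + m) = (\<Prod>i<2 * m. xvar (2 * m) i :: 'a::comm_ring_1 mpol)"
proof -
  let ?x = "xvar (2 * m) :: nat \<Rightarrow> 'a mpol"
  have "path_gen (2 * m) m l * path_gen (2 * m) m (l + m) = (\<Prod>i<m + m. ?x (l + i))"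
    unfolding prod.window_append path_gen_def by (simp only: add.assoc)
  also have "\<dots> = (\<Prod>i<2 * m. ?x i)"
    using prod.periodic_window[of ?x "2 * m" l] unfolding mult_2[symmetric] by (simp add: xvar_def)
  finally show ?thesis .
qed

lemma rees_map_h_gen: "rees_map (2 * m) m (h_gen (2 * m) l :: 'a::comm_ring_1 mpol) = 0"
proof -
  have "(path_gen (2 * m) m l * Var Z) * (path_gen (2 * m) m (l + m) * Var Z) =
      (\<Prod>i<2 * m. xvar (2 * m) i) * Var Z * (Var Z :: 'a mpol)" for l
    unfolding path_gen_antipodal[of m l, symmetric] by (simp only: mult_ac)
  from this[of l] this[of 0] show ?thesis
    by (simp add: h_gen_def rees_map_diff rees_map_mult rees_map_yvar)
qed

lemma h_gen_in_Ky:
  assumes "n > 0"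
  shows "h_gen n l \<in> carrier (ring_Ky n)"
  using assms unfolding h_gen_def ring_Ky_def yvar_def
  by (intro diff_in_poly_ring mult_in_poly_ring Var_mem) auto

lemma Ky_subset_T: "carrier (ring_Ky n) \<subseteq> carrier (ring_T n)"
  by (auto simp: ring_Ky_def ring_T_def poly_ring_def)

text \<open>Exponents do not involve coefficients, so the ideal \<open>J\<close> over the integers can be used.\<close>

lemma linked_image_exp:
  assumes "linked m k l" "m > 0" "k \<in> T_monos (2 * m)" "l \<in> T_monos (2 * m)"
  shows "image_exp (2 * m) m k = image_exp (2 * m) m l"
proof -
  have "monomial k - monomial l \<in> (rees_ideal (2 * m) m :: int mpol set)"
    using assms(1,2)
  proof (rule linked_imp_diff_in_ideal[OF _ _ ideal_rees_ideal])
    show "f_gen (2 * m) ` {1..2 * m} \<subseteq> (rees_ideal (2 * m) m :: int mpol set)"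
      using f_gen_in_rees_ideal[OF \<open>m > 0\<close>] by blast
    have "h_gen (2 * m) l \<in> (rees_ideal (2 * m) m :: int mpol set)" for l
      using h_gen_in_Ky[of "2 * m" l] Ky_subset_T[of "2 * m"] \<open>m > 0\<close>
      unfolding mem_rees_ideal_iff rees_map_h_gen by auto
    then show "h_gen (2 * m) ` {1..m - 1} \<subseteq> (rees_ideal (2 * m) m :: int mpol set)"
      by blast
  qed
  then have "(monomial (image_exp (2 * m) m k) :: int mpol) = monomial (image_exp (2 * m) m l)"
    using assms(3,4) by (simp add: mem_rees_ideal_iff rees_map_diff rees_map_monomial)
  then have "Poly_Mapping.lookup (monomial (image_exp (2 * m) m k) :: int mpol) (image_exp (2 * m) m l) = 1"
    by (simp add: monomial_def)
  then show ?thesis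
    by (simp add: monomial_def lookup_single when_def split: if_splits)
qed

text \<open>By induction on the degree: once the monomials are replaced by linked ones with a common
  variable, the cofactors have the same image and smaller degree.\<close>

lemma same_image_imp_linked:
  assumes "m > 0" "k \<in> T_monos (2 * m)" "l \<in> T_monos (2 * m)"
    and "image_exp (2 * m) m k = image_exp (2 * m) m l"
  shows "linked m k l"
  using assms(2-)
proof (induction "T_degree (2 * m) k" arbitrary: k l rule: less_induct)
  case less
  show ?case
  proof (cases "k = l")
    case True
    then show ?thesis using linked.reflexive by simp
  next
    case False
    obtain v r s where v: "linked m k (v + r)" "linked m l (v + s)" "T_degree (2 * m) v = 1"
      using linked_common_variable[OF \<open>m > 0\<close> less.prems False] .
    have T: "v + r \<in> T_monos (2 * m)" "v + s \<in> T_monos (2 * m)"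
      using linked_T_monos[OF v(1) \<open>m > 0\<close>] linked_T_monos[OF v(2) \<open>m > 0\<close>] less.prems by auto
    have "image_exp (2 * m) m (v + r) = image_exp (2 * m) m (v + s)"
      using linked_image_exp[OF v(1) \<open>m > 0\<close> less.prems(1) T(1)]
        linked_image_exp[OF v(2) \<open>m > 0\<close> less.prems(2) T(2)] less.prems(3) by simp
    then have "image_exp (2 * m) m r = image_exp (2 * m) m s"
      by (simp add: image_exp_add)
    moreover have "T_degree (2 * m) r < T_degree (2 * m) k"
      using linked_T_degree[OF v(1) \<open>m > 0\<close>] v(3) by (simp add: T_degree_add)
    ultimately have "linked m r s"
      using less.hyps[of r s] T T_monos_summand by blast
    then have "linked m (v + r) (v + s)"
      using linked.shift T(1) T_monos_summand by blast
    then show ?thesis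
      using v linked.transitive linked.symmetric by blast
  qed
qed

lemma sum_in_ideal:
  assumes "ideal I (ring_T n)" and "\<And>i. i \<in> A \<Longrightarrow> F i \<in> I"
  shows "sum F A \<in> I"
  using assms(2)
  by (induction A rule: infinite_finite_induct) (auto intro: ideal_T_closed(1,4)[OF assms(1)])

text \<open>
  Group the terms of \<open>p \<in> J\<close> by their image. Within a group the coefficients add up to a
  coefficient of \<open>\<phi>(p) = 0\<close>. So replacing each monomial by a fixed representative \<open>rep\<close> of its
  group turns \<open>p\<close> into \<open>0\<close>, while changing it by a combination of differences of monomials
  with the same image.
\<close>

lemma rees_ideal_subset_if_binomials:
  fixes I :: "'a::comm_ring_1 mpol set"
  assumes I: "ideal I (ring_T n)"
    and binomials: "\<And>k l. k \<in> T_monos n \<Longrightarrow> l \<in> T_monos n \<Longrightarrow>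
      image_exp n t k = image_exp n t l \<Longrightarrow> monomial k - monomial l \<in> I"
  shows "rees_ideal n t \<subseteq> I"
proof
  fix p :: "'a mpol" assume "p \<in> rees_ideal n t"
  then have p: "p \<in> carrier (ring_T n)" "rees_map n t p = 0"
    by (auto simp: mem_rees_ideal_iff)
  let ?K = "Poly_Mapping.keys p" and ?c = "Poly_Mapping.lookup p" and ?im = "image_exp n t"
  have K: "k \<in> T_monos n" if "k \<in> ?K" for k
    using p(1) that by (auto simp: ring_T_def poly_ring_def T_monos_def)
  have single_eq: "Poly_Mapping.single k c = Const c * (monomial k :: 'a mpol)" for k c
    by (simp add: Const_def monomial_def mult_single)
  define rep where "rep w = (SOME k. k \<in> ?K \<and> ?im k = w)" for w
  have rep: "rep (?im k) \<in> ?K" "?im (rep (?im k)) = ?im k" if "k \<in> ?K" for k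
    using someI[of "\<lambda>l. l \<in> ?K \<and> ?im l = ?im k" k] that by (auto simp: rep_def)
  have "rees_map n t p = rees_map n t (\<Sum>k\<in>?K. Poly_Mapping.single k (?c k))"
    by (simp add: mpol_decomp)
  also have "\<dots> = (\<Sum>k\<in>?K. rees_map n t (Const (?c k) * monomial k))"
    unfolding rees_map_def subst_sum single_eq ..
  also have "\<dots> = (\<Sum>k\<in>?K. Poly_Mapping.single (?im k) (?c k))"
    by (intro sum.cong refl) (simp add: rees_map_mult rees_map_Const rees_map_monomial K single_eq)
  finally have image: "(\<Sum>k\<in>?K. Poly_Mapping.single (?im k) (?c k)) = 0"
    using p(2) by simp
  have fibre: "(\<Sum>k\<in>{k \<in> ?K. ?im k = w}. ?c k) = 0" for w
  proof -
    have "(\<Sum>k\<in>{k \<in> ?K. ?im k = w}. ?c k) = (\<Sum>k\<in>?K. ?c k when ?im k = w)"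
      by (simp add: when_def sum.If_cases Int_def conj_commute)
    also have "\<dots> = Poly_Mapping.lookup (\<Sum>k\<in>?K. Poly_Mapping.single (?im k) (?c k)) w"
      by (simp add: lookup_sum lookup_single)
    finally show ?thesis by (simp add: image)
  qed
  have "(\<Sum>k\<in>?K. Poly_Mapping.single (rep (?im k)) (?c k)) =
      (\<Sum>w\<in>?im ` ?K. \<Sum>k\<in>{k \<in> ?K. ?im k = w}. Poly_Mapping.single (rep (?im k)) (?c k))"
    by (rule sum.image_gen) simp
  also have "\<dots> = (\<Sum>w\<in>?im ` ?K. Poly_Mapping.single (rep w) (\<Sum>k\<in>{k \<in> ?K. ?im k = w}. ?c k))"
    by (intro sum.cong refl poly_mapping_eqI) (auto simp: lookup_sum lookup_single when_def)
  also have "\<dots> = 0" by (simp add: fibre)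
  finally have "p = (\<Sum>k\<in>?K. Poly_Mapping.single k (?c k)) -
      (\<Sum>k\<in>?K. Poly_Mapping.single (rep (?im k)) (?c k))"
    by (simp add: mpol_decomp)
  also have "\<dots> = (\<Sum>k\<in>?K. Const (?c k) * (monomial k - monomial (rep (?im k))))"
    unfolding single_eq by (simp add: sum_subtractf right_diff_distrib)
  also have "\<dots> \<in> I"
  proof (intro sum_in_ideal[OF I] ideal_T_closed(2)[OF I])
    fix k assume "k \<in> ?K"
    then show "monomial k - monomial (rep (?im k)) \<in> I"
      using binomials K rep by simp
  qed (simp add: ring_T_def Const_mem)
  finally show "p \<in> I" .
qed

theorem theorem5p3:
  fixes n :: nat
  assumes "even n" and "n \<ge> 4"
  shows "(rees_ideal n (n div 2) :: 'a::field mpol set) =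
    ideal_L n <+>\<^bsub>ring_T n\<^esub> genideal (ring_T n) (ideal_H n)"
proof -
  define m where "m = n div 2"
  have n: "n = 2 * m" and m: "m > 0"
    using assms by (auto simp: m_def)
  let ?T = "ring_T n :: 'a mpol ring" and ?J = "rees_ideal n m :: 'a mpol set"
  let ?L = "ideal_L n :: 'a mpol set" and ?H = "ideal_H n :: 'a mpol set"
  let ?I = "?L <+>\<^bsub>?T\<^esub> genideal ?T ?H"
  interpret T: cring ?T by (rule cring_ring_T)
  interpret Ky: cring "ring_Ky n :: 'a mpol ring" unfolding ring_Ky_def by (rule cring_poly_ring)
  have J: "ideal ?J ?T" by (rule ideal_rees_ideal)
  have f_J: "f_gen n ` {1..n} \<subseteq> ?J"
    using f_gen_in_rees_ideal[OF m] by (auto simp: n)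
  have f_T: "f_gen n ` {1..n} \<subseteq> carrier ?T"
    using f_J by (auto simp: mem_rees_ideal_iff)
  have h_Ky: "h_gen n ` {1..n div 2 - 1} \<subseteq> carrier (ring_Ky n :: 'a mpol ring)"
    using h_gen_in_Ky[of n] m by (auto simp: n)
  have "(rees_map n m :: 'a mpol \<Rightarrow> _) \<in> ring_hom (ring_Ky n) (rees_algebra n m)"
    using ring_hom_closed[OF rees_map_hom[of n m]] Ky_subset_T[of n] ring_hom_one[OF rees_map_hom[of n m]]
    by (intro ring_hom_memI) (auto simp: rees_map_add rees_map_mult ring_Ky_def ring_T_def)
  \<comment> \<open>\<open>H\<close> is an ideal of \<open>K[y]\<close> and not of \<open>T\<close>, so its minimality is applied to the kernel of \<open>\<phi>\<close>
    restricted to \<open>K[y]\<close>.\<close>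
  then have "ideal (a_kernel (ring_Ky n) (rees_algebra n m) (rees_map n m)) (ring_Ky n :: 'a mpol ring)"
    by (intro ring_hom_ring.kernel_is_ideal ring_hom_ringI2 Ky.ring_axioms
        cring.axioms(1) cring_rees_algebra)
  moreover have "h_gen n ` {1..n div 2 - 1} \<subseteq>
      a_kernel (ring_Ky n :: 'a mpol ring) (rees_algebra n m) (rees_map n m)"
    using h_Ky rees_map_h_gen[of m] by (auto simp: a_kernel_def' n)
  ultimately have "?H \<subseteq> a_kernel (ring_Ky n) (rees_algebra n m) (rees_map n m)"
    unfolding ideal_H_def by (rule Ky.genideal_minimal)
  also have "\<dots> \<subseteq> ?J"
    using Ky_subset_T[of n, where 'a = 'a] by (auto simp: a_kernel_def' mem_rees_ideal_iff)
  finally have H_J: "?H \<subseteq> ?J" .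
  have H_T: "?H \<subseteq> carrier ?T"
    using H_J by (auto simp: mem_rees_ideal_iff)
  have L: "ideal ?L ?T"
    unfolding ideal_L_def by (rule T.genideal_ideal[OF f_T])
  have HT: "ideal (genideal ?T ?H) ?T"
    by (rule T.genideal_ideal[OF H_T])
  have I: "ideal ?I ?T" by (rule T.add_ideals[OF L HT])
  have "?L \<subseteq> ?J" unfolding ideal_L_def by (rule T.genideal_minimal[OF J f_J])
  moreover have "genideal ?T ?H \<subseteq> ?J" by (rule T.genideal_minimal[OF J H_J])
  ultimately have "?I \<subseteq> ?J"
    using ideal_T_closed(1)[OF J] by (auto simp: set_add_def' ring_T_def)
  moreover have "?J \<subseteq> ?I"
  proof (rule rees_ideal_subset_if_binomials[OF I])
    have "?L \<subseteq> ?I"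
      using ideal_T_closed(4)[OF HT] by (force simp: set_add_def' ring_T_def)
    then have f_I: "f_gen n ` {1..n} \<subseteq> ?I"
      using T.genideal_self[OF f_T] by (auto simp: ideal_L_def)
    have "genideal ?T ?H \<subseteq> ?I"
      using ideal_T_closed(4)[OF L] by (force simp: set_add_def' ring_T_def)
    moreover have "h_gen n ` {1..n div 2 - 1} \<subseteq> ?H"
      unfolding ideal_H_def by (rule Ky.genideal_self[OF h_Ky])
    ultimately have h_I: "h_gen n ` {1..m - 1} \<subseteq> ?I"
      using T.genideal_self[OF H_T] by (auto simp: m_def)
    fix k l assume "k \<in> T_monos n" "l \<in> T_monos n" "image_exp n m k = image_exp n m l"
    then have "linked m k l" using same_image_imp_linked[OF m] by (simp add: n)
    then show "monomial k - monomial l \<in> ?I"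
      using linked_imp_diff_in_ideal[OF _ m] I f_I h_I unfolding n by blast
  qed
  ultimately show ?thesis by (auto simp: m_def)
qed

end
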